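(* Let $X\subset\mathbb{R}^d$ be finite (scaled to minimum pairwise distance $1$ and coordinates in $[0,\Phi]$), and let $s$ be an integer. Let $\mu_1,\ldots,\mu_n$ (the dataset) and $\nu$ (the query) be probability distributions on $X$, each supported on at most $s$ points, and assume that for every one of these distributions there exists an integer $s'\le s$ such that the weights of all elements in its support are integer multiples of $1/s'$. Build a random quadtree on $X$ as described in the context. Then with probability at least $0.99$, any nearest neighbor of $\nu$ among $\mu_1,\ldots,\mu_n$ with respect to the Flowtree distance $\widetilde W_1$ is an $O(\log^2 s)$-approximate nearest neighbor of $\nu$ with respect to the $W_1$ distance.
   Context: The ground metric on $X$ is Euclidean and $W_1(\mu,\nu)=\min_\tau\sum_{x_1,x_2\in X}\tau(x_1,x_2)\|x_1-x_2\|$ over distributions $\tau$ on $X\times X$ with marginals $\mu,\nu$. A distribution $\mu_i$ is a $c$-approximate nearest neighbor of $\nu$ if $W_1(\mu_i,\nu)\le c\cdot\min_j W_1(\mu_j,\nu)$. Quadtree construction: with $\sigma\in\mathbb{R}^d$ having i.i.d. coordinates uniform in $[0,\Phi]$, the root is $H=[-\Phi,\Phi]^d+\sigma$; each hypercube is recursively halved along every dimension, keeping only non-empty sub-hypercubes, and hypercubes containing exactly one point of $X$ are leaves. Levels are numbered $\log\Phi+1$ at the root and downward; an edge between level $\ell+1$ and level $\ell$ has weight $2^\ell$; $t(x,x')$ is the tree path weight between the leaves of $x,x'$. Flowtree distance: for distributions $\mu,\nu$, let $f$ be an optimal flow for the tree metric, i.e. a minimizer of $\sum_{x,x'}\tilde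 f(x,x')t(x,x')$ over distributions $\tilde f$ on $X\times X$ with marginals $\mu,\nu$, and set $\widetilde W_1(\mu,\nu)=\sum_{x,x'}f(x,x')\|x-x'\|$.
   Formalization: The constant in O(log^2 s) may depend on the dimension d (a constant independent of d is impossible for the Euclidean ground metric: the ratio can grow like d^(1/4) with s = 2), and log^2 s is replaced by max(1, log^2 s), since for s = 1 the literal factor is 0. *)

theory Defs
  imports "HOL-Probability.Probability"
begin

definition scaled :: "real \<Rightarrow> (real ^ 'd) set \<Rightarrow> bool" where
  "scaled \<Phi> X \<longleftrightarrow> finite X \<and>
     (\<forall>x\<in>X. \<forall>i. 0 \<le> x $ i \<and> x $ i \<le> \<Phi>) \<and>
     (\<forall>x\<in>X. \<forall>y\<in>X. x \<noteq> y \<longrightarrow> 1 \<le> norm (x - y)) \<and>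
     (2 \<le> card X \<longrightarrow> (\<exists>x\<in>X. \<exists>y\<in>X. norm (x - y) = 1))"

definition quantized :: "nat \<Rightarrow> 'a pmf \<Rightarrow> bool" where
  "quantized s \<mu> \<longleftrightarrow> card (set_pmf \<mu>) \<le> s \<and>
     (\<exists>s'::nat. 1 \<le> s' \<and> s' \<le> s \<and>
        (\<forall>x\<in>set_pmf \<mu>. \<exists>m::int. pmf \<mu> x = of_int m * (1 / real s')))"


section \<open>Transport\<close>

definition couplings :: "'a set \<Rightarrow> 'a pmf \<Rightarrow> 'a pmf \<Rightarrow> ('a \<times> 'a) pmf set" where
  "couplings X \<mu> \<nu> =
     {\<tau>. set_pmf \<tau> \<subseteq> X \<times> X \<and> map_pmf fst \<tau> = \<mu> \<and> map_pmf snd \<tau> = \<nu>}"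

definition transport_cost :: "'a set \<Rightarrow> ('a \<Rightarrow> 'a \<Rightarrow> real) \<Rightarrow> ('a \<times> 'a) pmf \<Rightarrow> real" where
  "transport_cost X c \<tau> = (\<Sum>(x, x')\<in>X \<times> X. pmf \<tau> (x, x') * c x x')"

definition optimal_flow ::
    "'a set \<Rightarrow> ('a \<Rightarrow> 'a \<Rightarrow> real) \<Rightarrow> 'a pmf \<Rightarrow> 'a pmf \<Rightarrow> ('a \<times> 'a) pmf \<Rightarrow> bool" where
  "optimal_flow X c \<mu> \<nu> f \<longleftrightarrow> is_arg_min (transport_cost X c) (\<lambda>\<tau>. \<tau> \<in> couplings X \<mu> \<nu>) f"

abbreviation eucl_cost :: "(real ^ 'd) set \<Rightarrow> ((real ^ 'd) \<times> (real ^ 'd)) pmf \<Rightarrow> real" where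
  "eucl_cost X \<equiv> transport_cost X (\<lambda>x x'. norm (x - x'))"

text \<open>The infimum is attained when \<open>X\<close> is finite and carries both distributions.\<close>

definition W1 :: "(real ^ 'd) set \<Rightarrow> (real ^ 'd) pmf \<Rightarrow> (real ^ 'd) pmf \<Rightarrow> real" where
  "W1 X \<mu> \<nu> = (INF \<tau>\<in>couplings X \<mu> \<nu>. eucl_cost X \<tau>)"

definition approx_nearest ::
    "(real ^ 'd) set \<Rightarrow> real \<Rightarrow> nat \<Rightarrow> (nat \<Rightarrow> (real ^ 'd) pmf) \<Rightarrow> (real ^ 'd) pmf \<Rightarrow> nat \<Rightarrow> bool" where
  "approx_nearest X c n \<mu> \<nu> i \<longleftrightarrow>
     i \<in> {1..n} \<and> W1 X (\<mu> i) \<nu> \<le> c * Min ((\<lambda>j. W1 X (\<mu> j) \<nu>) ` {1..n})"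


section \<open>The randomly shifted quadtree\<close>

text \<open>
  Hypercubes are half-open, so that the \<open>2 ^ d\<close> halves of a hypercube partition it. Compared with
  a closed root, this only matters on the null event that some point of \<open>X\<close> lies on an upper face
  of the root.
\<close>

definition hypercube :: "real ^ 'd \<Rightarrow> real \<Rightarrow> (real ^ 'd) set" where
  "hypercube a r = {x. \<forall>i. a $ i \<le> x $ i \<and> x $ i < a $ i + r}"

definition side :: "real \<Rightarrow> nat \<Rightarrow> real" where
  "side \<Phi> k = 2 * \<Phi> / 2 ^ k"

text \<open>
  A node is given by its depth \<open>k\<close> (the root has depth 0) and the lower corner of its hypercube,
  which has side length \<open>side \<Phi> k\<close>. A node with a single point of \<open>X\<close> is a leaf and is not split.
\<close>

inductive quadtree_node :: "(real ^ 'd) set \<Rightarrow> real \<Rightarrow> real ^ 'd \<Rightarrow> nat \<Rightarrow> real ^ 'd \<Rightarrow> bool"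
  for X :: "(real ^ 'd) set" and \<Phi> :: real and \<sigma> :: "real ^ 'd" where
  root: "quadtree_node X \<Phi> \<sigma> 0 (\<sigma> - (\<chi> i. \<Phi>))"
| child: "\<lbrakk>quadtree_node X \<Phi> \<sigma> k a;
           2 \<le> card (X \<inter> hypercube a (side \<Phi> k));
           \<forall>i. a' $ i = a $ i \<or> a' $ i = a $ i + side \<Phi> (Suc k);
           X \<inter> hypercube a' (side \<Phi> (Suc k)) \<noteq> {}\<rbrakk>
          \<Longrightarrow> quadtree_node X \<Phi> \<sigma> (Suc k) a'"

text \<open>The level of a node of depth \<open>k\<close>; an integer if \<open>\<Phi>\<close> is a power of two. In general it is a
  real number, and the side length of the hypercube is still 2 to the power of its level.\<close>

definition level :: "real \<Rightarrow> nat \<Rightarrow> real" where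
  "level \<Phi> k = log 2 \<Phi> + 1 - real k"

text \<open>The nodes whose hypercube contains \<open>x\<close> are those on the path from the root to the leaf of \<open>x\<close>.\<close>

definition root_path :: "(real ^ 'd) set \<Rightarrow> real \<Rightarrow> real ^ 'd \<Rightarrow> real ^ 'd \<Rightarrow> (nat \<times> (real ^ 'd)) set" where
  "root_path X \<Phi> \<sigma> x = {(k, a). quadtree_node X \<Phi> \<sigma> k a \<and> x \<in> hypercube a (side \<Phi> k)}"

text \<open>
  Each edge is identified with its lower end node. The edges of the path between the leaves of
  \<open>x\<close> and \<open>x'\<close> are those on exactly one of the two paths from the root; an edge whose lower end has
  level \<open>l\<close> has weight \<open>2 powr l\<close>.
\<close>

definition tree_dist ::
    "(real ^ 'd) set \<Rightarrow> real \<Rightarrow> real ^ 'd \<Rightarrow> real ^ 'd \<Rightarrow> real ^ 'd \<Rightarrow> real" where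
  "tree_dist X \<Phi> \<sigma> x x' =
     (\<Sum>(k, a) \<in> (root_path X \<Phi> \<sigma> x - root_path X \<Phi> \<sigma> x') \<union>
                  (root_path X \<Phi> \<sigma> x' - root_path X \<Phi> \<sigma> x). 2 powr level \<Phi> k)"

definition shift_measure :: "real \<Rightarrow> ('d::finite \<Rightarrow> real) measure" where
  "shift_measure \<Phi> = (\<Pi>\<^sub>M i\<in>UNIV. uniform_measure lborel {0..\<Phi>})"


section \<open>Flowtree nearest neighbors\<close>

text \<open>
  An optimal flow for the tree metric need not be unique, and the Flowtree distance depends on the
  one chosen. Here \<open>F j\<close> is the flow chosen for \<open>\<mu> j\<close> and \<open>\<nu>\<close>, so that \<open>eucl_cost X (F j)\<close> is their
  Flowtree distance; an index counts as a nearest neighbor if it is one for some choice.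
\<close>

definition flowtree_nearest ::
    "(real ^ 'd) set \<Rightarrow> real \<Rightarrow> real ^ 'd \<Rightarrow> nat \<Rightarrow> (nat \<Rightarrow> (real ^ 'd) pmf) \<Rightarrow> (real ^ 'd) pmf \<Rightarrow> nat \<Rightarrow> bool"
  where
  "flowtree_nearest X \<Phi> \<sigma> n \<mu> \<nu> i \<longleftrightarrow> i \<in> {1..n} \<and>
     (\<exists>F. (\<forall>j\<in>{1..n}. optimal_flow X (tree_dist X \<Phi> \<sigma>) (\<mu> j) \<nu> (F j)) \<and>
          (\<forall>j\<in>{1..n}. eucl_cost X (F i) \<le> eucl_cost X (F j)))"

end

theory Submission
  imports Defs
begin

text \<open>
  The tree metric dominates the Euclidean metric up to a factor of the dimension, which the constant
  may depend on. It therefore suffices to bound the tree cost of one near-optimal coupling of \<open>\<nu>\<close>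
  with its nearest neighbor: the optimal tree flow costs no more, and \<open>n\<close> plays no role. A pair at
  distance \<open>\<delta>\<close> is separated at side length \<open>r\<close> with probability \<open>O(\<delta> / r)\<close> and then pays \<open>O(r)\<close>.
  By a union bound over the at most \<open>s\<^sup>2\<close> pairs, no pair is separated at side length above
  \<open>O(s\<^sup>2 \<delta>)\<close>; the levels below \<open>\<delta>\<close> contribute a geometric sum, and each of the \<open>O(log s)\<close>
  remaining levels contributes \<open>O(\<delta>)\<close> in expectation. Markov's inequality finishes the argument.
\<close>

section \<open>Cells of the quadtree\<close>

text \<open>Index of the grid cell of \<open>x\<close> at depth \<open>k\<close>, with the grid
  anchored at the lower corner of the root. It is defined for every point and depth, whether or not
  the tree has a node there, so that sharing a hypercube becomes an equation between integer
  vectors.\<close>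

definition cell :: "real \<Rightarrow> real ^ 'd \<Rightarrow> nat \<Rightarrow> real ^ 'd \<Rightarrow> int ^ 'd" where
  "cell \<Phi> \<sigma> k x = (\<chi> i. \<lfloor>(x $ i - \<sigma> $ i + \<Phi>) / side \<Phi> k\<rfloor>)"

definition corner :: "real \<Rightarrow> real ^ 'd \<Rightarrow> nat \<Rightarrow> real ^ 'd \<Rightarrow> real ^ 'd" where
  "corner \<Phi> \<sigma> k x = (\<chi> i. \<sigma> $ i - \<Phi> + side \<Phi> k * of_int (cell \<Phi> \<sigma> k x $ i))"

lemma side_pos: "\<Phi> > 0 \<Longrightarrow> side \<Phi> k > 0"
  by (simp add: side_def)

lemma side_Suc: "side \<Phi> k = 2 * side \<Phi> (Suc k)"
  by (simp add: side_def)

lemma powr_level: "\<Phi> > 0 \<Longrightarrow> 2 powr level \<Phi> k = side \<Phi> k"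
  by (simp add: level_def side_def powr_diff powr_add powr_realpow)

text \<open>Doubling the side halves the quotient, and taking floors turns halving into
  \<open>div 2\<close>. Thus the grids are nested.\<close>

lemma cell_Suc:
  assumes "\<Phi> > 0"
  shows "cell \<Phi> \<sigma> k x $ i = cell \<Phi> \<sigma> (Suc k) x $ i div 2"
proof -
  have "(x $ i - \<sigma> $ i + \<Phi>) / side \<Phi> k = (x $ i - \<sigma> $ i + \<Phi>) / side \<Phi> (Suc k) / of_int 2"
    by (simp add: side_Suc[of \<Phi> k])
  then show ?thesis
    unfolding cell_def by (simp only: vec_lambda_beta floor_divide_real_eq_div)
qed

lemma cell_eq_mono:
  assumes "\<Phi> > 0" "cell \<Phi> \<sigma> k x = cell \<Phi> \<sigma> k y" "j \<le> k"
  shows "cell \<Phi> \<sigma> j x = cell \<Phi> \<sigma> j y"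
proof -
  have "cell \<Phi> \<sigma> k x = cell \<Phi> \<sigma> k y \<longrightarrow> cell \<Phi> \<sigma> j x = cell \<Phi> \<sigma> j y"
    using assms(3)
  proof (induction k rule: dec_induct)
    case (step k)
    then show ?case
      by (metis assms(1) cell_Suc vec_eq_iff)
  qed simp
  then show ?thesis using assms(2) by simp
qed

lemma cell_component_eq_iff:
  assumes "\<Phi> > 0"
  shows "cell \<Phi> \<sigma> k x $ i = c \<longleftrightarrow>
    \<sigma> $ i - \<Phi> + side \<Phi> k * of_int c \<le> x $ i \<and> x $ i < \<sigma> $ i - \<Phi> + side \<Phi> k * of_int c + side \<Phi> k"
  using side_pos[OF assms, of k]
  by (auto simp: cell_def floor_eq_iff field_simps)

lemma in_hypercube_corner_iff:
  assumes "\<Phi> > 0"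
  shows "y \<in> hypercube (corner \<Phi> \<sigma> k x) (side \<Phi> k) \<longleftrightarrow> cell \<Phi> \<sigma> k y = cell \<Phi> \<sigma> k x"
  by (auto simp: hypercube_def vec_eq_iff corner_def cell_component_eq_iff[OF assms])

lemma corner_eq_iff:
  assumes "\<Phi> > 0"
  shows "corner \<Phi> \<sigma> k x = corner \<Phi> \<sigma> k y \<longleftrightarrow> cell \<Phi> \<sigma> k x = cell \<Phi> \<sigma> k y"
  using side_pos[OF assms, of k] by (auto simp: vec_eq_iff corner_def)

section \<open>Nodes and root paths in terms of cells\<close>

definition split_at :: "(real ^ 'd) set \<Rightarrow> real \<Rightarrow> real ^ 'd \<Rightarrow> nat \<Rightarrow> real ^ 'd \<Rightarrow> bool" where
  "split_at X \<Phi> \<sigma> k x \<longleftrightarrow> 2 \<le> card {y \<in> X. cell \<Phi> \<sigma> k y = cell \<Phi> \<sigma> k x}"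

text \<open>Replaces the induction of \<open>quadtree_node\<close> by a condition on the parent
  alone: if the parent's cell holds two points of \<open>X\<close>, so do all larger cells around
  it. The equation at depth 0 says that \<open>x\<close> lies in the root.\<close>

definition on_path :: "(real ^ 'd) set \<Rightarrow> real \<Rightarrow> real ^ 'd \<Rightarrow> nat \<Rightarrow> real ^ 'd \<Rightarrow> bool" where
  "on_path X \<Phi> \<sigma> k x \<longleftrightarrow>
     cell \<Phi> \<sigma> 0 x = 0 \<and> (case k of 0 \<Rightarrow> True | Suc j \<Rightarrow> split_at X \<Phi> \<sigma> j x)"

lemma card_hypercube_corner:
  assumes "\<Phi> > 0"
  shows "card (X \<inter> hypercube (corner \<Phi> \<sigma> k x) (side \<Phi> k)) = card {y \<in> X. cell \<Phi> \<sigma> k y = cell \<Phi> \<sigma> k x}"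
  by (rule arg_cong[of _ _ card]) (auto simp: in_hypercube_corner_iff[OF assms])

lemma corner_root:
  assumes "cell \<Phi> \<sigma> 0 x = 0"
  shows "corner \<Phi> \<sigma> 0 x = \<sigma> - (\<chi> i. \<Phi>)"
  using assms by (auto simp: vec_eq_iff corner_def)

text \<open>Passing to a child keeps a coordinate of the corner or raises it by the child's side, so
  every corner lies on the grid of its depth, and a grid hypercube containing \<open>x\<close> can
  only be the cell of \<open>x\<close>.\<close>

lemma quadtree_node_path:
  assumes "\<Phi> > 0" "quadtree_node X \<Phi> \<sigma> k a" "x \<in> hypercube a (side \<Phi> k)"
  shows "a = corner \<Phi> \<sigma> k x \<and> on_path X \<Phi> \<sigma> k x"
  using assms(2,3)
proof (induction arbitrary: x rule: quadtree_node.induct)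
  case root
  have "cell \<Phi> \<sigma> 0 x $ i = 0" for i
    using root unfolding cell_component_eq_iff[OF assms(1)] by (auto simp: hypercube_def)
  then have "cell \<Phi> \<sigma> 0 x = 0"
    by (simp add: vec_eq_iff)
  then show ?case
    by (simp add: on_path_def corner_root)
next
  case (child k a a')
  have pos: "side \<Phi> (Suc k) > 0" and two: "side \<Phi> k = 2 * side \<Phi> (Suc k)"
    by (rule side_pos[OF assms(1)], rule side_Suc)
  have "x \<in> hypercube a (side \<Phi> k)"
    unfolding hypercube_def
  proof (clarify)
    fix i
    have "a' $ i \<le> x $ i \<and> x $ i < a' $ i + side \<Phi> (Suc k)"
      using child.prems by (auto simp: hypercube_def)
    then show "a $ i \<le> x $ i \<and> x $ i < a $ i + side \<Phi> k"
      using child.hyps(3)[rule_format, of i] pos two by auto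
  qed
  then have a: "a = corner \<Phi> \<sigma> k x" and p: "on_path X \<Phi> \<sigma> k x"
    using child.IH by auto
  have "split_at X \<Phi> \<sigma> k x"
    using child.hyps(2) unfolding a split_at_def card_hypercube_corner[OF assms(1)] .
  moreover have "a' $ i = corner \<Phi> \<sigma> (Suc k) x $ i" for i
  proof -
    \<comment> \<open>The two halves of the parent's cell in coordinate \<open>i\<close> have twice
      its index, plus 0 or 1.\<close>
    define c where "c = 2 * cell \<Phi> \<sigma> k x $ i + (if a' $ i = a $ i then 0 else 1)"
    have a'c: "a' $ i = \<sigma> $ i - \<Phi> + side \<Phi> (Suc k) * of_int c"
      using child.hyps(3)[rule_format, of i] unfolding a c_def corner_def two
      by (auto simp: algebra_simps)
    moreover have "a' $ i \<le> x $ i \<and> x $ i < a' $ i + side \<Phi> (Suc k)"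
      using child.prems by (auto simp: hypercube_def)
    ultimately have "cell \<Phi> \<sigma> (Suc k) x $ i = c"
      unfolding cell_component_eq_iff[OF assms(1)] by simp
    then show ?thesis
      by (simp add: corner_def a'c)
  qed
  ultimately show ?case
    using p by (auto simp: on_path_def vec_eq_iff)
qed

text \<open>By nesting, \<open>split_at\<close> passes from a depth to all smaller ones, so the tree
  reaches the cell of \<open>x\<close> through a chain of split ancestors.\<close>

lemma quadtree_node_corner:
  assumes "\<Phi> > 0" "finite X" "x \<in> X" "on_path X \<Phi> \<sigma> k x"
  shows "quadtree_node X \<Phi> \<sigma> k (corner \<Phi> \<sigma> k x)"
  using assms(4)
proof (induction k)
  case 0
  then show ?case
    using quadtree_node.root[of X \<Phi> \<sigma>] by (simp add: on_path_def corner_root)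
next
  case (Suc k)
  then have sp: "split_at X \<Phi> \<sigma> k x" and r: "cell \<Phi> \<sigma> 0 x = 0"
    by (auto simp: on_path_def)
  have "split_at X \<Phi> \<sigma> j x" if "j \<le> k" for j
  proof -
    have "card {y \<in> X. cell \<Phi> \<sigma> k y = cell \<Phi> \<sigma> k x} \<le> card {y \<in> X. cell \<Phi> \<sigma> j y = cell \<Phi> \<sigma> j x}"
      using assms(2) cell_eq_mono[OF assms(1) _ that] by (intro card_mono) auto
    then show ?thesis
      using sp by (simp add: split_at_def)
  qed
  then have "on_path X \<Phi> \<sigma> k x"
    using r by (auto simp: on_path_def split: nat.split)
  then have node: "quadtree_node X \<Phi> \<sigma> k (corner \<Phi> \<sigma> k x)"
    by (rule Suc.IH)
  show ?case
  proof (rule quadtree_node.child[OF node])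
    show "2 \<le> card (X \<inter> hypercube (corner \<Phi> \<sigma> k x) (side \<Phi> k))"
      using sp by (simp add: split_at_def card_hypercube_corner[OF assms(1)])
    show "X \<inter> hypercube (corner \<Phi> \<sigma> (Suc k) x) (side \<Phi> (Suc k)) \<noteq> {}"
      using assms(3) in_hypercube_corner_iff[OF assms(1), of x \<sigma> "Suc k" x] by blast
    show "\<forall>i. corner \<Phi> \<sigma> (Suc k) x $ i = corner \<Phi> \<sigma> k x $ i \<or>
              corner \<Phi> \<sigma> (Suc k) x $ i = corner \<Phi> \<sigma> k x $ i + side \<Phi> (Suc k)"
    proof
      fix i
      define c where "c = cell \<Phi> \<sigma> (Suc k) x $ i"
      \<comment> \<open>The two remainders modulo 2 are the two choices that a child has for its
        corner.\<close>
      have "c = 2 * (c div 2) \<or> c = 2 * (c div 2) + 1"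
        by presburger
      then have "real_of_int c = 2 * of_int (c div 2) \<or> real_of_int c = 2 * of_int (c div 2) + 1"
        by linarith
      then show "corner \<Phi> \<sigma> (Suc k) x $ i = corner \<Phi> \<sigma> k x $ i \<or>
              corner \<Phi> \<sigma> (Suc k) x $ i = corner \<Phi> \<sigma> k x $ i + side \<Phi> (Suc k)"
        unfolding corner_def vec_lambda_beta cell_Suc[OF assms(1), of \<sigma> k] c_def[symmetric] side_Suc[of \<Phi> k]
        by (auto simp: algebra_simps)
    qed
  qed
qed

lemma root_path_eq:
  assumes "\<Phi> > 0" "finite X" "x \<in> X"
  shows "root_path X \<Phi> \<sigma> x = (\<lambda>k. (k, corner \<Phi> \<sigma> k x)) ` {k. on_path X \<Phi> \<sigma> k x}"
  using quadtree_node_path[OF assms(1), of X \<sigma>] quadtree_node_corner[OF assms, of \<sigma>]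
    in_hypercube_corner_iff[OF assms(1)]
  by (fastforce simp: root_path_def)

lemma on_path_cong:
  assumes "\<Phi> > 0" "cell \<Phi> \<sigma> k x = cell \<Phi> \<sigma> k y"
  shows "on_path X \<Phi> \<sigma> k x = on_path X \<Phi> \<sigma> k y"
proof -
  have "cell \<Phi> \<sigma> j x = cell \<Phi> \<sigma> j y" if "j \<le> k" for j
    using cell_eq_mono[OF assms that] .
  then show ?thesis
    by (auto simp: on_path_def split_at_def split: nat.split)
qed

lemma norm_le_side:
  fixes x y :: "real ^ 'd"
  assumes "\<Phi> > 0" "cell \<Phi> \<sigma> k x = cell \<Phi> \<sigma> k y"
  shows "norm (x - y) \<le> real CARD('d) * side \<Phi> k"
proof -
  have "\<bar>(x - y) $ i\<bar> \<le> side \<Phi> k" for i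
    using cell_component_eq_iff[OF assms(1), of \<sigma> k x i "cell \<Phi> \<sigma> k x $ i"]
      cell_component_eq_iff[OF assms(1), of \<sigma> k y i "cell \<Phi> \<sigma> k x $ i"] assms(2)
    by auto
  then have "(\<Sum>i\<in>UNIV. \<bar>(x - y) $ i\<bar>) \<le> real CARD('d) * side \<Phi> k"
    using sum_bounded_above[of UNIV "\<lambda>i. \<bar>(x - y) $ i\<bar>" "side \<Phi> k"] by simp
  then show ?thesis
    using norm_le_l1_cart[of "x - y"] by linarith
qed

section \<open>Finite depth, and the tree metric as a sum over depths\<close>

lemma split_atE:
  assumes "finite X" "split_at X \<Phi> \<sigma> k x"
  obtains y z where "y \<in> X" "z \<in> X" "y \<noteq> z" "cell \<Phi> \<sigma> k y = cell \<Phi> \<sigma> k z"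
proof -
  have "\<not> card {y \<in> X. cell \<Phi> \<sigma> k y = cell \<Phi> \<sigma> k x} \<le> Suc 0"
    using assms(2) by (simp add: split_at_def)
  then show ?thesis
    using that assms(1) by (subst (asm) card_le_Suc0_iff_eq) auto
qed

text \<open>Points in a common cell are at most the dimension times its side apart, which finally
  drops below the minimum distance 1. This \<open>K\<close> is the same for all shifts, so sums over
  depths can be cut off before \<sigma> is drawn.\<close>

lemma ex_depth:
  fixes X :: "(real ^ 'd) set"
  assumes "\<Phi> > 0" "scaled \<Phi> X"
  shows "\<exists>K. \<forall>k\<ge>K. \<forall>\<sigma>. \<forall>x\<in>X. \<forall>y\<in>X. cell \<Phi> \<sigma> k x = cell \<Phi> \<sigma> k y \<longrightarrow> x = y"
proof -
  obtain K where K: "real CARD('d) * (2 * \<Phi>) < 2 ^ K"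
    using real_arch_pow[of 2] by auto
  have "x = y" if "k \<ge> K" "x \<in> X" "y \<in> X" "cell \<Phi> \<sigma> k x = cell \<Phi> \<sigma> k y" for k \<sigma> and x y :: "real ^ 'd"
  proof (rule ccontr)
    assume "x \<noteq> y"
    then have "1 \<le> norm (x - y)"
      using assms(2) that by (auto simp: scaled_def)
    also have "\<dots> \<le> real CARD('d) * side \<Phi> k"
      using norm_le_side[OF assms(1) that(4)] .
    also have "\<dots> < 1"
    proof -
      have "(2::real) ^ K \<le> 2 ^ k"
        using that(1) by simp
      with K have "real CARD('d) * (2 * \<Phi>) < 2 ^ k"
        by linarith
      then show ?thesis
        by (simp add: side_def field_simps)
    qed
    finally show False by simp
  qed
  then show ?thesis by blast
qed

text \<open>An edge is its lower node, and two root paths share their node at depth \<open>k\<close>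
  exactly if the cells agree there. So a depth with different cells contributes its side once for
  each path that reaches it, and no path goes deeper than \<open>K\<close>.\<close>

lemma tree_dist_eq:
  assumes "\<Phi> > 0" "finite X"
    and K: "\<forall>k\<ge>K. \<forall>y\<in>X. \<forall>z\<in>X. cell \<Phi> \<sigma> k y = cell \<Phi> \<sigma> k z \<longrightarrow> y = z"
    and x: "x \<in> X" and y: "y \<in> X"
  shows "tree_dist X \<Phi> \<sigma> x y =
    (\<Sum>k\<le>K. of_bool (cell \<Phi> \<sigma> k x \<noteq> cell \<Phi> \<sigma> k y) * side \<Phi> k *
      (of_bool (on_path X \<Phi> \<sigma> k x) + of_bool (on_path X \<Phi> \<sigma> k y)))"
proof -
  have bound: "k \<le> K" if "on_path X \<Phi> \<sigma> k z" for k z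
  proof (rule ccontr)
    assume *: "\<not> k \<le> K"
    then obtain j where j: "k = Suc j" "K \<le> j"
      by (cases k) auto
    then have "split_at X \<Phi> \<sigma> j z"
      using that by (simp add: on_path_def)
    then show False
      using K j(2) split_atE[OF assms(2)] by metis
  qed
  let ?D = "\<lambda>u v. (\<lambda>k. (k, corner \<Phi> \<sigma> k u)) ` {k \<in> {..K}. on_path X \<Phi> \<sigma> k u \<and> cell \<Phi> \<sigma> k u \<noteq> cell \<Phi> \<sigma> k v}"
  have diff: "root_path X \<Phi> \<sigma> u - root_path X \<Phi> \<sigma> v = ?D u v" if "u \<in> X" "v \<in> X" for u v
    unfolding root_path_eq[OF assms(1,2) that(1)] root_path_eq[OF assms(1,2) that(2)]
    using on_path_cong[OF assms(1), of \<sigma> _ u v X] bound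
    by (intro set_eqI) (auto simp: image_iff corner_eq_iff[OF assms(1)])
  have sumD: "(\<Sum>(k, a) \<in> ?D u v. 2 powr level \<Phi> k) =
      (\<Sum>k\<le>K. of_bool (cell \<Phi> \<sigma> k u \<noteq> cell \<Phi> \<sigma> k v) * side \<Phi> k * of_bool (on_path X \<Phi> \<sigma> k u))" for u v
    by (subst sum.reindex)
      (auto simp: inj_on_def powr_level[OF assms(1)] sum.inter_filter intro!: sum.cong)
  have "?D x y \<inter> ?D y x = {}"
    using corner_eq_iff[OF assms(1), of \<sigma>] by auto
  then have "tree_dist X \<Phi> \<sigma> x y =
      (\<Sum>(k, a) \<in> ?D x y. 2 powr level \<Phi> k) + (\<Sum>(k, a) \<in> ?D y x. 2 powr level \<Phi> k)"
    unfolding tree_dist_def diff[OF x y] diff[OF y x] by (intro sum.union_disjoint) auto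
  then show ?thesis
    unfolding sumD by (simp only: distrib_left sum.distrib eq_commute[of "cell \<Phi> \<sigma> _ y"])
qed

lemma tree_dist_self: "tree_dist X \<Phi> \<sigma> x x = 0"
  by (simp add: tree_dist_def)

text \<open>Each path has at most one edge per depth. Dropping the \<open>on_path\<close> conditions
  leaves the separation events as the only randomness.\<close>

lemma tree_dist_le:
  assumes "\<Phi> > 0" "finite X"
    and K: "\<forall>k\<ge>K. \<forall>y\<in>X. \<forall>z\<in>X. cell \<Phi> \<sigma> k y = cell \<Phi> \<sigma> k z \<longrightarrow> y = z"
    and "x \<in> X" "y \<in> X"
  shows "tree_dist X \<Phi> \<sigma> x y \<le> (\<Sum>k\<le>K. of_bool (cell \<Phi> \<sigma> k x \<noteq> cell \<Phi> \<sigma> k y) * (2 * side \<Phi> k))"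
  unfolding tree_dist_eq[OF assms]
  using side_pos[OF assms(1)] by (intro sum_mono) (auto simp: less_imp_le)

text \<open>Let \<open>Suc j\<close> be the first depth that separates the points; the root
  hypotheses exclude depth 0. The common cell at depth \<open>j\<close> contains both points and is
  therefore split, so both paths have an edge at depth \<open>Suc j\<close>. The two weights add up
  to \<open>side \<Phi> j\<close>, and \<open>norm_le_side\<close> applies at depth
  \<open>j\<close>.\<close>

lemma norm_le_tree_dist:
  fixes x y :: "real ^ 'd"
  assumes "\<Phi> > 0" "finite X"
    and K: "\<forall>k\<ge>K. \<forall>y\<in>X. \<forall>z\<in>X. cell \<Phi> \<sigma> k y = cell \<Phi> \<sigma> k z \<longrightarrow> y = z"
    and x: "x \<in> X" and y: "y \<in> X" and root: "cell \<Phi> \<sigma> 0 x = 0" "cell \<Phi> \<sigma> 0 y = 0"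
  shows "norm (x - y) \<le> real CARD('d) * tree_dist X \<Phi> \<sigma> x y"
proof (cases "x = y")
  case True
  then show ?thesis
    by (simp add: tree_dist_self)
next
  case False
  define k where "k = (LEAST k. cell \<Phi> \<sigma> k x \<noteq> cell \<Phi> \<sigma> k y)"
  have KK: "cell \<Phi> \<sigma> K x \<noteq> cell \<Phi> \<sigma> K y"
    using K x y False by auto
  have k: "cell \<Phi> \<sigma> k x \<noteq> cell \<Phi> \<sigma> k y" and "k \<le> K"
    unfolding k_def using KK by (rule LeastI, rule Least_le)
  have "k \<noteq> 0"
    using k root by metis
  then obtain j where j: "k = Suc j"
    using not0_implies_Suc by auto
  have same: "cell \<Phi> \<sigma> j x = cell \<Phi> \<sigma> j y"
    using not_less_Least[of j "\<lambda>k. cell \<Phi> \<sigma> k x \<noteq> cell \<Phi> \<sigma> k y"] j unfolding k_def by auto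
  have "card {x, y} \<le> card {z \<in> X. cell \<Phi> \<sigma> j z = cell \<Phi> \<sigma> j x}"
    using assms(2) x y same by (intro card_mono) auto
  then have "split_at X \<Phi> \<sigma> j x" "split_at X \<Phi> \<sigma> j y"
    using False same by (auto simp: split_at_def)
  then have on: "on_path X \<Phi> \<sigma> k x" "on_path X \<Phi> \<sigma> k y"
    using root by (auto simp: on_path_def j)
  have "side \<Phi> j = of_bool (cell \<Phi> \<sigma> k x \<noteq> cell \<Phi> \<sigma> k y) * side \<Phi> k *
      (of_bool (on_path X \<Phi> \<sigma> k x) + of_bool (on_path X \<Phi> \<sigma> k y))"
    using on k by (simp add: j side_Suc[of \<Phi> j])
  also have "\<dots> \<le> tree_dist X \<Phi> \<sigma> x y"
    unfolding tree_dist_eq[OF assms(1-5)]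
    using \<open>k \<le> K\<close> side_pos[OF assms(1)] by (intro member_le_sum) (auto simp: less_imp_le)
  finally have "real CARD('d) * side \<Phi> j \<le> real CARD('d) * tree_dist X \<Phi> \<sigma> x y"
    by (intro mult_left_mono) auto
  then show ?thesis
    using norm_le_side[OF assms(1) same] by linarith
qed

section \<open>Sums over dyadic side lengths\<close>

lemma sum_side_le:
  assumes "\<Phi> > 0" "finite S" "\<And>k. k \<in> S \<Longrightarrow> side \<Phi> k < a" "a > 0"
  shows "(\<Sum>k\<in>S. side \<Phi> k) \<le> 2 * a"
proof (cases "S = {}")
  case False
  have "(\<Sum>k\<in>S. side \<Phi> k) \<le> (\<Sum>k = Min S..<Suc (Max S). side \<Phi> k)"
    using assms(2) side_pos[OF assms(1)] by (intro sum_mono2) (auto simp: less_imp_le less_Suc_eq_le)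
  \<comment> \<open>The side halves with each depth, so the sum telescopes and is controlled by its
    shallowest term.\<close>
  also have "\<dots> = (\<Sum>k = Min S..<Suc (Max S). - 2 * side \<Phi> (Suc k) - (- 2 * side \<Phi> k))"
    by (intro sum.cong) (simp_all add: side_def)
  also have "\<dots> = - 2 * side \<Phi> (Suc (Max S)) - (- 2 * side \<Phi> (Min S))"
    using assms(2) False by (intro sum_Suc_diff') (meson Max_in Min_le le_SucI)
  also have "\<dots> \<le> 2 * side \<Phi> (Min S)"
    using side_pos[OF assms(1), of "Suc (Max S)"] by simp
  also have "\<dots> \<le> 2 * a"
    using assms(3)[of "Min S"] assms(2) False by (simp add: less_imp_le)
  finally show ?thesis .
qed (use assms in auto)

text \<open>Reciprocals double with each depth, so the deepest term controls the sum. A union bound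
  over all coarse depths thus loses only a factor 2.\<close>

lemma sum_inverse_side_le:
  assumes "\<Phi> > 0" "finite S" "\<And>k. k \<in> S \<Longrightarrow> a \<le> side \<Phi> k" "a > 0"
  shows "(\<Sum>k\<in>S. 1 / side \<Phi> k) \<le> 2 / a"
proof (cases "S = {}")
  case False
  have "(\<Sum>k\<in>S. 1 / side \<Phi> k) \<le> (\<Sum>k = 0..<Suc (Max S). 1 / side \<Phi> k)"
    using assms(2) side_pos[OF assms(1)] by (intro sum_mono2) (auto simp: less_imp_le less_Suc_eq_le)
  also have "\<dots> = (\<Sum>k = 0..<Suc (Max S). 1 / side \<Phi> (Suc k) - 1 / side \<Phi> k)"
    by (intro sum.cong) (simp_all add: side_def field_simps)
  also have "\<dots> = 1 / side \<Phi> (Suc (Max S)) - 1 / side \<Phi> 0"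
    by (rule sum_Suc_diff') simp
  also have "\<dots> \<le> 2 / side \<Phi> (Max S)"
    using assms(1) by (simp add: side_def)
  also have "\<dots> \<le> 2 / a"
    using assms(3)[of "Max S"] assms(2,4) False by (simp add: frac_le)
  finally show ?thesis .
qed (use assms in auto)

text \<open>Between the extreme depths of \<open>S\<close> the side shrinks by a power of 2 that is
  at most \<open>b / a\<close>; the \<open>+ 1\<close> counts both ends.\<close>

lemma card_side_between:
  assumes "\<Phi> > 0" "finite S" "\<And>k. k \<in> S \<Longrightarrow> a \<le> side \<Phi> k \<and> side \<Phi> k \<le> b" "0 < a" "a \<le> b"
  shows "real (card S) \<le> log 2 (b / a) + 1"
proof (cases "S = {}")
  case True
  then show ?thesis
    using assms by (simp add: zero_le_log_cancel_iff)
next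
  case False
  define m M where "m = Min S" and "M = Max S"
  have mM: "m \<in> S" "M \<in> S" "m \<le> M"
    using False assms(2) by (auto simp: m_def M_def)
  have "S \<subseteq> {m..M}"
    using assms(2) by (auto simp: m_def M_def)
  then have "card S \<le> Suc M - m"
    using card_mono[of "{m..M}" S] by simp
  moreover have "(2::real) ^ (M - m) = side \<Phi> m / side \<Phi> M"
    using assms(1) mM(3) by (simp add: side_def power_diff)
  moreover have "side \<Phi> m / side \<Phi> M \<le> b / a"
    using assms(3-5) mM by (intro frac_le) auto
  ultimately have "2 powr real (M - m) \<le> b / a" and *: "card S \<le> M - m + 1"
    using mM(3) by (auto simp: powr_realpow simp del: of_nat_diff)
  then have "real (M - m) \<le> log 2 (b / a)"
    using assms(4,5) by (subst le_log_iff) auto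
  then show ?thesis
    using * by linarith
qed

section \<open>The random shift\<close>

lemma prob_space_shift: "\<Phi> > 0 \<Longrightarrow> prob_space (shift_measure \<Phi> :: ('d::finite \<Rightarrow> real) measure)"
  unfolding shift_measure_def by (intro prob_space_PiM prob_space_uniform_measure) auto

lemma space_shift: "space (shift_measure \<Phi>) = UNIV"
  by (simp add: shift_measure_def space_PiM)

lemma measurable_shift_component [measurable]: "(\<lambda>\<sigma>. \<sigma> i) \<in> borel_measurable (shift_measure \<Phi>)"
proof -
  have "(\<lambda>\<sigma>. \<sigma> i) \<in> measurable (shift_measure \<Phi>) (uniform_measure lborel {0..\<Phi>})"
    unfolding shift_measure_def by (rule measurable_component_singleton) simp
  then show ?thesis
    by (simp add: measurable_def)
qed

lemma measure_shift_component:
  fixes i :: "'d::finite"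
  assumes "\<Phi> > 0" "B \<in> sets borel"
  shows "measure (shift_measure \<Phi>) {\<sigma>. \<sigma> i \<in> B} = measure lborel ({0..\<Phi>} \<inter> B) / \<Phi>"
proof -
  let ?U = "uniform_measure lborel {0..\<Phi>}"
  interpret product_prob_space "\<lambda>_::'d. ?U" UNIV
    using assms by (intro product_prob_spaceI prob_space_uniform_measure) auto
  have "emeasure (shift_measure \<Phi>) {\<sigma>. \<sigma> i \<in> B} = emeasure ?U B"
    using emeasure_PiM_Collect_single[of i B] assms(2)
    by (simp add: shift_measure_def space_PiM)
  then have "measure (shift_measure \<Phi>) {\<sigma>. \<sigma> i \<in> B} = measure ?U B"
    by (simp add: measure_def)
  also have "\<dots> = measure lborel ({0..\<Phi>} \<inter> B) / measure lborel {0..\<Phi>}"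
    using assms by (intro measure_uniform_measure) auto
  finally show ?thesis
    using assms(1) by simp
qed

lemma measurable_cell_component [measurable]:
  "(\<lambda>\<sigma>. cell \<Phi> (vec_lambda \<sigma>) k x $ i) \<in> measurable (shift_measure \<Phi>) (count_space UNIV)"
  unfolding cell_def vec_lambda_beta by measurable

lemma measurable_cell_eq [measurable]:
  "Measurable.pred (shift_measure \<Phi>) (\<lambda>\<sigma>. cell \<Phi> (vec_lambda \<sigma>) k x = cell \<Phi> (vec_lambda \<sigma>) k y)"
  unfolding vec_eq_iff by measurable

text \<open>In coordinate \<open>i\<close> the root reaches from \<open>\<sigma> i - \<Phi>\<close>
  up to, but excluding, \<open>\<sigma> i + \<Phi>\<close>. This covers all values in
  \<open>{0..\<Phi>}\<close> once \<open>0 < \<sigma> i\<close> and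
  \<open>\<sigma> i \<le> \<Phi>\<close>, so only a null event is lost.\<close>

lemma AE_in_root:
  fixes X :: "(real ^ 'd) set"
  assumes "\<Phi> > 0" "scaled \<Phi> X"
  shows "AE \<sigma> in shift_measure \<Phi>. \<forall>x\<in>X. cell \<Phi> (vec_lambda \<sigma>) 0 x = 0"
proof -
  interpret prob_space "shift_measure \<Phi> :: ('d \<Rightarrow> real) measure"
    by (rule prob_space_shift[OF assms(1)])
  have "AE \<sigma> in shift_measure \<Phi>. \<forall>i::'d. 0 < \<sigma> i \<and> \<sigma> i \<le> \<Phi>"
  proof (subst AE_all_countable, intro allI)
    fix i :: 'd
    have "{0..\<Phi>} \<inter> - {0<..\<Phi>} = {0}"
      using assms(1) by auto
    then have "measure (shift_measure \<Phi>) {\<sigma>. \<sigma> i \<in> - {0<..\<Phi>}} = 0"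
      by (subst measure_shift_component[OF assms(1)]) auto
    moreover have "{\<sigma>. \<sigma> i \<in> - {0<..\<Phi>}} \<in> sets (shift_measure \<Phi>)"
      using measurable_sets[OF measurable_shift_component[of i \<Phi>], of "- {0<..\<Phi>}"]
      by (simp add: vimage_def space_shift)
    ultimately show "AE \<sigma> in shift_measure \<Phi>. 0 < \<sigma> i \<and> \<sigma> i \<le> \<Phi>"
      by (intro AE_I[where N = "{\<sigma>. \<sigma> i \<in> - {0<..\<Phi>}}"]) (auto simp: emeasure_eq_measure)
  qed
  then show ?thesis
  proof eventually_elim
    case (elim \<sigma>)
    have "cell \<Phi> (vec_lambda \<sigma>) 0 x $ i = 0" if "x \<in> X" for x i
    proof -
      have "0 \<le> x $ i \<and> x $ i \<le> \<Phi>"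
        using assms(2) that by (auto simp: scaled_def)
      then show ?thesis
        using elim[rule_format, of i] unfolding cell_component_eq_iff[OF assms(1)]
        by (simp add: side_def)
    qed
    then show ?case
      by (auto simp: vec_eq_iff)
  qed
qed

text \<open>The floors differ only if a grid boundary falls into \<open>{a<..b}\<close>. For the
  \<open>m\<close>-th boundary above the root's lower corner this confines \<open>t\<close> to an
  interval of length \<open>b - a\<close>, and for \<open>t\<close> in \<open>{0..\<Phi>}\<close>
  only the boundaries 1 to \<open>2 ^ k\<close> come into question.\<close>

lemma measure_floor_ne:
  assumes "\<Phi> > 0" "0 \<le> a" "a \<le> b" "b \<le> \<Phi>"
  shows "measure lborel ({0..\<Phi>} \<inter> {t. \<lfloor>(a - t + \<Phi>) / side \<Phi> k\<rfloor> \<noteq> \<lfloor>(b - t + \<Phi>) / side \<Phi> k\<rfloor>}) \<le> 2 ^ k * (b - a)"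
    (is "measure _ ?T \<le> _")
proof -
  define r where "r = side \<Phi> k"
  have r: "r > 0" "2 * \<Phi> / r = 2 ^ k"
    using assms(1) side_pos by (auto simp: r_def side_def)
  define I where "I m = {a + \<Phi> - real m * r<..b + \<Phi> - real m * r}" for m
  have "?T \<subseteq> (\<Union>m\<in>{1..2 ^ k}. I m)"
  proof
    fix t assume t: "t \<in> ?T"
    define z where "z = \<lfloor>(b - t + \<Phi>) / r\<rfloor>"
    have "\<lfloor>(a - t + \<Phi>) / r\<rfloor> \<le> z"
      unfolding z_def using r assms(3) by (intro floor_mono divide_right_mono) auto
    then have lt: "\<lfloor>(a - t + \<Phi>) / r\<rfloor> < z"
      using t by (auto simp: z_def r_def)
    have "0 \<le> (a - t + \<Phi>) / r"
      using t assms r by auto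
    then have "0 < z"
      using lt by (simp add: floor_less_iff)
    have up: "of_int z \<le> (b - t + \<Phi>) / r"
      by (simp add: z_def)
    also have "\<dots> \<le> 2 ^ k"
      unfolding r(2)[symmetric] using t assms r by (intro divide_right_mono) auto
    finally have "z \<le> 2 ^ k"
      by (metis of_int_le_iff of_int_numeral of_int_power)
    moreover have "a - t + \<Phi> < of_int z * r" "of_int z * r \<le> b - t + \<Phi>"
      using lt up r by (simp_all add: floor_less_iff field_simps)
    ultimately have "t \<in> I (nat z)" "nat z \<in> {1..2 ^ k}"
      using \<open>0 < z\<close> by (auto simp: I_def nat_le_iff)
    then show "t \<in> (\<Union>m\<in>{1..2 ^ k}. I m)"
      by blast
  qed
  moreover have "?T \<in> sets lborel"
    by measurable
  moreover have "I m \<in> fmeasurable lborel" for m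
    using assms(3) by (intro fmeasurableI) (auto simp: I_def)
  then have "(\<Union>m\<in>{1..2 ^ k}. I m) \<in> fmeasurable lborel"
    by (intro fmeasurable.finite_UN) auto
  ultimately have "measure lborel ?T \<le> measure lborel (\<Union>m\<in>{1..2 ^ k}. I m)"
    by (intro measure_mono_fmeasurable)
  also have "\<dots> \<le> (\<Sum>m\<in>{1..2 ^ k}. measure lborel (I m))"
    by (intro measure_UNION_le) (auto simp: I_def)
  also have "\<dots> = 2 ^ k * (b - a)"
    using assms(3) by (simp add: I_def)
  finally show ?thesis .
qed

text \<open>Union bound over the coordinates. The density \<open>1 / \<Phi>\<close> turns the factor
  \<open>2 ^ k\<close> of a single coordinate into \<open>2 / side \<Phi> k\<close>.\<close>

lemma prob_cell_ne:
  fixes x y :: "real ^ 'd"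
  assumes "\<Phi> > 0" "scaled \<Phi> X" "x \<in> X" "y \<in> X"
  shows "measure (shift_measure \<Phi>) {\<sigma>. cell \<Phi> (vec_lambda \<sigma>) k x \<noteq> cell \<Phi> (vec_lambda \<sigma>) k y}
           \<le> 2 * real CARD('d) * norm (x - y) / side \<Phi> k"
proof -
  interpret prob_space "shift_measure \<Phi> :: ('d \<Rightarrow> real) measure"
    by (rule prob_space_shift[OF assms(1)])
  have coord: "prob {\<sigma>. cell \<Phi> (vec_lambda \<sigma>) k x $ i \<noteq> cell \<Phi> (vec_lambda \<sigma>) k y $ i}
      \<le> 2 * norm (x - y) / side \<Phi> k" for i
  proof -
    define T where "T = {t. \<lfloor>(x $ i - t + \<Phi>) / side \<Phi> k\<rfloor> \<noteq> \<lfloor>(y $ i - t + \<Phi>) / side \<Phi> k\<rfloor>}"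
    have b: "0 \<le> x $ i" "x $ i \<le> \<Phi>" "0 \<le> y $ i" "y $ i \<le> \<Phi>"
      using assms by (auto simp: scaled_def)
    have "Measurable.pred borel (\<lambda>t. \<lfloor>(x $ i - t + \<Phi>) / side \<Phi> k\<rfloor> = \<lfloor>(y $ i - t + \<Phi>) / side \<Phi> k\<rfloor>)"
      by measurable
    then have "Measurable.pred borel (\<lambda>t. \<lfloor>(x $ i - t + \<Phi>) / side \<Phi> k\<rfloor> \<noteq> \<lfloor>(y $ i - t + \<Phi>) / side \<Phi> k\<rfloor>)"
      by measurable
    then have "T \<in> sets borel"
      by (simp add: T_def pred_def)
    moreover have "{\<sigma>. cell \<Phi> (vec_lambda \<sigma>) k x $ i \<noteq> cell \<Phi> (vec_lambda \<sigma>) k y $ i} = {\<sigma>. \<sigma> i \<in> T}"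
      by (simp add: cell_def T_def)
    ultimately have coord_eq: "prob {\<sigma>. cell \<Phi> (vec_lambda \<sigma>) k x $ i \<noteq> cell \<Phi> (vec_lambda \<sigma>) k y $ i}
        = measure lborel ({0..\<Phi>} \<inter> T) / \<Phi>"
      using measure_shift_component[OF assms(1)] by simp
    have "measure lborel ({0..\<Phi>} \<inter> T) \<le> 2 ^ k * \<bar>(x - y) $ i\<bar>"
    proof (cases "x $ i \<le> y $ i")
      case True
      then show ?thesis
        using measure_floor_ne[OF assms(1) b(1) True b(4), of k] by (simp add: T_def)
    next
      case False
      then show ?thesis
        using measure_floor_ne[OF assms(1) b(3) _ b(2), of k]
        by (simp add: T_def eq_commute[of "\<lfloor>(x $ i - _ + \<Phi>) / side \<Phi> k\<rfloor>"])
    qed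
    also have "2 ^ k * \<bar>(x - y) $ i\<bar> \<le> 2 ^ k * norm (x - y)"
      by (intro mult_left_mono component_le_norm_cart) auto
    finally have "measure lborel ({0..\<Phi>} \<inter> T) / \<Phi> \<le> 2 ^ k * norm (x - y) / \<Phi>"
      using assms(1) by (simp add: divide_right_mono)
    also have "\<dots> = 2 * norm (x - y) / side \<Phi> k"
      by (simp add: side_def)
    finally show ?thesis
      using coord_eq by simp
  qed
  have "{\<sigma>. cell \<Phi> (vec_lambda \<sigma>) k x \<noteq> cell \<Phi> (vec_lambda \<sigma>) k y} =
      (\<Union>i. {\<sigma>. cell \<Phi> (vec_lambda \<sigma>) k x $ i \<noteq> cell \<Phi> (vec_lambda \<sigma>) k y $ i})"
    by (auto simp: vec_eq_iff)
  also have "prob \<dots> \<le> (\<Sum>i\<in>UNIV. prob {\<sigma>. cell \<Phi> (vec_lambda \<sigma>) k x $ i \<noteq> cell \<Phi> (vec_lambda \<sigma>) k y $ i})"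
  proof (intro measure_UNION_le)
    fix i
    have "Measurable.pred (shift_measure \<Phi>) (\<lambda>\<sigma>. cell \<Phi> (vec_lambda \<sigma>) k x $ i \<noteq> cell \<Phi> (vec_lambda \<sigma>) k y $ i)"
      by measurable
    then show "{\<sigma>. cell \<Phi> (vec_lambda \<sigma>) k x $ i \<noteq> cell \<Phi> (vec_lambda \<sigma>) k y $ i} \<in> events"
      by (simp add: pred_def space_shift)
  qed simp
  also have "\<dots> \<le> (\<Sum>i\<in>(UNIV :: 'd set). 2 * norm (x - y) / side \<Phi> k)"
    by (intro sum_mono coord)
  finally show ?thesis
    by (simp add: algebra_simps)
qed

section \<open>Tree cost of a fixed flow\<close>

lemma sum_truncated_le:
  assumes "\<Phi> > 0" "0 < \<delta>" "\<delta> \<le> R" "\<And>k. q k \<le> 1" "\<And>k. q k * side \<Phi> k \<le> b" "0 \<le> b"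
  shows "(\<Sum>k\<in>{k\<in>{..K}. side \<Phi> k < R}. q k * (2 * side \<Phi> k)) \<le> 4 * \<delta> + 2 * b * (log 2 (R / \<delta>) + 1)"
proof -
  \<comment> \<open>Here \<open>q k\<close> plays the separation probability. On \<open>?L\<close>
    only \<open>q k \<le> 1\<close> is used and the sides sum geometrically; on \<open>?M\<close>
    every depth costs at most \<open>2 * b\<close>, and there are logarithmically many.\<close>
  let ?L = "{k\<in>{..K}. side \<Phi> k < \<delta>}" and ?M = "{k\<in>{..K}. \<delta> \<le> side \<Phi> k \<and> side \<Phi> k < R}"
  have "{k\<in>{..K}. side \<Phi> k < R} = ?L \<union> ?M"
    using assms(3) by auto
  then have split: "(\<Sum>k\<in>{k\<in>{..K}. side \<Phi> k < R}. q k * (2 * side \<Phi> k)) =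
      (\<Sum>k\<in>?L. q k * (2 * side \<Phi> k)) + (\<Sum>k\<in>?M. q k * (2 * side \<Phi> k))"
    by (simp only:) (intro sum.union_disjoint, auto)
  have "(\<Sum>k\<in>?L. q k * (2 * side \<Phi> k)) \<le> (\<Sum>k\<in>?L. 2 * side \<Phi> k)"
  proof (rule sum_mono)
    show "q k * (2 * side \<Phi> k) \<le> 2 * side \<Phi> k" for k
      using mult_right_mono[OF assms(4)[of k], of "2 * side \<Phi> k"] side_pos[OF assms(1), of k] by simp
  qed
  also have "\<dots> \<le> 2 * (2 * \<delta>)"
    unfolding sum_distrib_left[symmetric]
    using assms(1,2) by (intro mult_left_mono sum_side_le) auto
  finally have low: "(\<Sum>k\<in>?L. q k * (2 * side \<Phi> k)) \<le> 4 * \<delta>"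
    by simp
  have "(\<Sum>k\<in>?M. q k * (2 * side \<Phi> k)) \<le> (\<Sum>k\<in>?M. 2 * b)"
    using assms(5) by (intro sum_mono) (simp add: mult.left_commute)
  also have "\<dots> = 2 * b * real (card ?M)"
    by simp
  also have "\<dots> \<le> 2 * b * (log 2 (R / \<delta>) + 1)"
    using assms by (intro mult_left_mono card_side_between) auto
  finally show ?thesis
    using split low by linarith
qed

text \<open>The strict inequality makes the bound valid also for \<open>c = 0\<close>.\<close>

lemma (in prob_space) prob_gt_le:
  fixes Z :: "'a \<Rightarrow> real"
  assumes Z: "integrable M Z" "\<And>x. 0 \<le> Z x" and le: "expectation Z \<le> q * c" and "0 < q"
  shows "prob {x \<in> space M. c < Z x} \<le> q"
proof (cases "0 < c")
  case True
  have [measurable]: "Z \<in> borel_measurable M"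
    using Z(1) by auto
  have "prob {x \<in> space M. c < Z x} \<le> prob {x \<in> space M. c \<le> Z x}"
    by (intro finite_measure_mono) auto
  also have "\<dots> \<le> expectation Z / c"
    using Z True by (intro integral_Markov_inequality_measure[where A = "space M"]) auto
  also have "\<dots> \<le> q"
    using le True by (simp add: field_simps)
  finally show ?thesis .
next
  case False
  have [measurable]: "Z \<in> borel_measurable M"
    using Z(1) by auto
  have "0 \<le> expectation Z"
    using Z(2) by simp
  moreover have "q * c \<le> 0"
    using False \<open>0 < q\<close> by (simp add: mult_nonneg_nonpos)
  ultimately have "expectation Z = 0" "q * c = 0"
    using le by linarith+
  then have "AE x in M. Z x = 0" "c = 0"
    using integral_nonneg_eq_0_iff_AE[OF Z(1)] Z(2) \<open>0 < q\<close> by auto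
  then have "prob {x \<in> space M. c < Z x} = 0"
    by (subst prob_Collect_eq_0) auto
  then show ?thesis
    using \<open>0 < q\<close> by simp
qed

text \<open>Leaves only pairs at positive distance, and no more of them than the support of
  \<open>f\<close> has elements, as the union bound requires.\<close>

lemma transport_cost_offdiag:
  assumes "finite X" "set_pmf f \<subseteq> X \<times> X" "\<And>x. c x x = 0"
  shows "transport_cost X c f = (\<Sum>p\<in>{p\<in>set_pmf f. fst p \<noteq> snd p}. pmf f p * c (fst p) (snd p))"
  unfolding transport_cost_def case_prod_unfold prod.collapse
  using assms by (intro sum.mono_neutral_right) (auto simp: set_pmf_iff)

text \<open>As \<open>f\<close> is fixed before the shift is drawn, expectations can be taken pair
  by pair. The bad event is \<open>B1\<close>, some pair being separated at a large side, together
  with \<open>B2\<close>, the remaining cost being large; each has probability at most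
  1/250.\<close>

lemma tree_cost_bound:
  fixes X :: "(real ^ 'd) set"
  assumes \<Phi>: "\<Phi> > 0" and X: "scaled \<Phi> X" and f: "set_pmf f \<subseteq> X \<times> X"
    and card: "card (set_pmf f) \<le> s\<^sup>2" and s: "1 \<le> s"
  defines "d \<equiv> real CARD('d)"
  shows "\<exists>B\<in>sets (shift_measure \<Phi>). measure (shift_measure \<Phi>) B \<le> 1 / 125 \<and>
    (\<forall>\<sigma>. \<sigma> \<notin> B \<longrightarrow> transport_cost X (tree_dist X \<Phi> (vec_lambda \<sigma>)) f \<le>
      250 * ((4 + 4 * d * (log 2 (1000 * d) + 3)) * max 1 ((log 2 (real s))\<^sup>2)) * eucl_cost X f)"
proof -
  interpret prob_space "shift_measure \<Phi> :: ('d \<Rightarrow> real) measure"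
    by (rule prob_space_shift[OF \<Phi>])
  have finX: "finite X"
    using X by (simp add: scaled_def)
  have d: "1 \<le> d"
    by (simp add: d_def Suc_leI)
  obtain K where K: "\<forall>k\<ge>K. \<forall>\<sigma>. \<forall>x\<in>X. \<forall>y\<in>X. cell \<Phi> \<sigma> k x = cell \<Phi> \<sigma> k y \<longrightarrow> x = y"
    using ex_depth[OF \<Phi> X] by blast
  \<comment> \<open>\<open>L\<close> dominates both 1 and \<open>log 2 s\<close>, so it absorbs
    constants and the linear logarithm alike; at \<open>s = 1\<close>, where the logarithm vanishes,
    the maximum keeps it positive.\<close>
  define L where "L = max 1 ((log 2 (real s))\<^sup>2)"
  have L1: "1 \<le> L"
    by (simp add: L_def)
  have Ls: "log 2 (real s) \<le> L"
  proof (cases "log 2 (real s) \<le> 1")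
    case False
    then have "log 2 (real s) * 1 \<le> log 2 (real s) * log 2 (real s)"
      by (intro mult_left_mono) auto
    then show ?thesis
      by (simp add: L_def power2_eq_square)
  qed (simp add: L_def)
  \<comment> \<open>The summand 4 pays for the depths with side below \<open>\<delta> p\<close>. The
    other one is \<open>2 * b / \<delta> p\<close> for \<open>b = 2 * d * \<delta> p\<close>, times
    a bound on the number of depths up to \<open>R p\<close> from which \<open>L\<close> has been
    factored out.\<close>
  define A where "A = 4 + 4 * d * (log 2 (1000 * d) + 3)"
  define P where "P = {p\<in>set_pmf f. fst p \<noteq> snd p}"
  define \<delta> where "\<delta> p = norm (fst p - snd p)" for p :: "(real ^ 'd) \<times> (real ^ 'd)"
  \<comment> \<open>At side length at least \<open>R p\<close>, the pair \<open>p\<close> is separated with probability at most \<open>1 / (250 s\<^sup>2)\<close>,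
    which allows a union bound over the at most \<open>s\<^sup>2\<close> pairs.\<close>
  define R where "R p = 1000 * d * (real s)\<^sup>2 * \<delta> p" for p
  define N where "N k p = {\<sigma> :: 'd \<Rightarrow> real. cell \<Phi> (vec_lambda \<sigma>) k (fst p) \<noteq> cell \<Phi> (vec_lambda \<sigma>) k (snd p)}" for k p
  have N[measurable]: "N k p \<in> events" for k p
  proof -
    have "Measurable.pred (shift_measure \<Phi>) (\<lambda>\<sigma>. cell \<Phi> (vec_lambda \<sigma>) k (fst p) \<noteq> cell \<Phi> (vec_lambda \<sigma>) k (snd p))"
      by measurable
    then show ?thesis
      by (simp add: N_def pred_def space_shift)
  qed
  have finf: "finite (set_pmf f)"
    using f finX by (meson finite_SigmaI finite_subset)
  then have finP: "finite P"
    by (simp add: P_def)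
  have cardP: "real (card P) \<le> (real s)\<^sup>2"
  proof -
    have "card P \<le> s\<^sup>2"
      using card_mono[OF finf, of P] card by (auto simp: P_def)
    then show ?thesis
      by (metis of_nat_le_iff of_nat_power)
  qed
  have P: "fst p \<in> X" "snd p \<in> X" "0 < \<delta> p" if "p \<in> P" for p
    using that f by (auto simp: P_def \<delta>_def)
  have s2: "1 \<le> (real s)\<^sup>2"
    using s by simp
  have R: "\<delta> p \<le> R p" "0 < R p" if "p \<in> P" for p
  proof -
    have "1 * 1 \<le> (1000 * d) * (real s)\<^sup>2"
      using d s2 by (intro mult_mono) auto
    then show "\<delta> p \<le> R p" 
      using P(3)[OF that] mult_right_mono[of 1 "1000 * d * (real s)\<^sup>2" "\<delta> p"] by (simp add: R_def)
    then show "0 < R p"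
      using P(3)[OF that] by simp
  qed
  have probN: "prob (N k p) \<le> 2 * d * \<delta> p / side \<Phi> k" if "p \<in> P" for k p
    using prob_cell_ne[OF \<Phi> X P(1,2)[OF that]] by (simp add: N_def \<delta>_def d_def)
  define B1 where "B1 = (\<Union>p\<in>P. \<Union>k\<in>{k\<in>{..K}. R p \<le> side \<Phi> k}. N k p)"
  define J where "J k p = indicat_real (N k p)" for k p
  \<comment> \<open>Outside \<open>B1\<close> this dominates the tree cost of \<open>f\<close>: the
    depths with side at least \<open>R p\<close> are left out.\<close>
  define Z where "Z \<sigma> = (\<Sum>p\<in>P. pmf f p *
      (\<Sum>k\<in>{k\<in>{..K}. side \<Phi> k < R p}. J k p \<sigma> * (2 * side \<Phi> k)))" for \<sigma>
  \<comment> \<open>The factor 250 is the price of Markov's inequality at failure probability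
    1/250.\<close>
  define c where "c = 250 * (A * L) * eucl_cost X f"
  have B1: "B1 \<in> events"
    using finP by (auto simp: B1_def)
  have "prob B1 \<le> (\<Sum>p\<in>P. prob (\<Union>k\<in>{k\<in>{..K}. R p \<le> side \<Phi> k}. N k p))"
    unfolding B1_def using finP by (intro measure_UNION_le) auto
  also have "\<dots> \<le> (\<Sum>p\<in>P. 1 / (250 * (real s)\<^sup>2))"
  proof (rule sum_mono)
    fix p assume p: "p \<in> P"
    have "prob (\<Union>k\<in>{k\<in>{..K}. R p \<le> side \<Phi> k}. N k p) \<le> (\<Sum>k\<in>{k\<in>{..K}. R p \<le> side \<Phi> k}. prob (N k p))"
      by (intro measure_UNION_le) auto
    also have "\<dots> \<le> (\<Sum>k\<in>{k\<in>{..K}. R p \<le> side \<Phi> k}. 2 * d * \<delta> p * (1 / side \<Phi> k))"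
      using probN[OF p] by (intro sum_mono) simp
    also have "\<dots> = 2 * d * \<delta> p * (\<Sum>k\<in>{k\<in>{..K}. R p \<le> side \<Phi> k}. 1 / side \<Phi> k)"
      by (simp only: sum_distrib_left)
    also have "\<dots> \<le> 2 * d * \<delta> p * (2 / R p)"
      using \<Phi> d P(3)[OF p] R(2)[OF p] by (intro mult_left_mono sum_inverse_side_le) auto
    also have "\<dots> = 1 / (250 * (real s)\<^sup>2)"
      using d P(3)[OF p] s by (simp add: R_def field_simps)
    finally show "prob (\<Union>k\<in>{k\<in>{..K}. R p \<le> side \<Phi> k}. N k p) \<le> 1 / (250 * (real s)\<^sup>2)" .
  qed
  also have "\<dots> = real (card P) / (250 * (real s)\<^sup>2)"
    by simp
  also have "\<dots> \<le> 1 / 250"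
    using divide_right_mono[OF cardP, of "250 * (real s)\<^sup>2"] s by simp
  finally have pB1: "prob B1 \<le> 1 / 250" .
  have intJ: "integrable (shift_measure \<Phi>) (J k p)" and EJ: "expectation (J k p) = prob (N k p)" for k p
    unfolding J_def by (auto intro!: integrable_real_indicator simp: emeasure_eq_measure space_shift)
  have intZ: "integrable (shift_measure \<Phi>) Z"
    unfolding Z_def by (intro Bochner_Integration.integrable_sum integrable_mult_right integrable_mult_left intJ)
  have "expectation Z = (\<Sum>p\<in>P. pmf f p *
      (\<Sum>k\<in>{k\<in>{..K}. side \<Phi> k < R p}. prob (N k p) * (2 * side \<Phi> k)))"
    unfolding Z_def by (simp add: Bochner_Integration.integral_sum intJ EJ)
  also have "\<dots> \<le> (\<Sum>p\<in>P. pmf f p * (A * L * \<delta> p))"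
  proof (intro sum_mono mult_left_mono)
    fix p assume p: "p \<in> P"
    \<comment> \<open>The expected contribution of one depth has a bound free of \<open>k\<close>:
      larger sides separate more rarely in the same proportion.\<close>
    have "prob (N k p) * side \<Phi> k \<le> 2 * d * \<delta> p" for k
      using probN[OF p, of k] side_pos[OF \<Phi>, of k] by (simp add: field_simps)
    then have "(\<Sum>k\<in>{k\<in>{..K}. side \<Phi> k < R p}. prob (N k p) * (2 * side \<Phi> k)) \<le>
        4 * \<delta> p + 2 * (2 * d * \<delta> p) * (log 2 (R p / \<delta> p) + 1)"
      using d P(3)[OF p] by (intro sum_truncated_le \<Phi> R(1)[OF p]) auto
    also have "R p / \<delta> p = 1000 * d * (real s)\<^sup>2"
      using P(3)[OF p] by (simp add: R_def)
    also have "log 2 \<dots> = log 2 (1000 * d) + 2 * log 2 (real s)"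
      using d s by (simp add: log_mult_pos log_nat_power)
    also have "4 * \<delta> p + 2 * (2 * d * \<delta> p) * (log 2 (1000 * d) + 2 * log 2 (real s) + 1) \<le>
        4 * (L * \<delta> p) + 2 * (2 * d * \<delta> p) * ((log 2 (1000 * d) + 3) * L)"
    proof (intro add_mono mult_left_mono)
      show "\<delta> p \<le> L * \<delta> p"
        using L1 P(3)[OF p] by simp
      have "0 \<le> log 2 (1000 * d)"
        using d by (intro zero_le_log_cancel_iff[THEN iffD2]) auto
      then have "(log 2 (1000 * d) + 1) * 1 \<le> (log 2 (1000 * d) + 1) * L"
        using L1 by (intro mult_left_mono) auto
      then show "log 2 (1000 * d) + 2 * log 2 (real s) + 1 \<le> (log 2 (1000 * d) + 3) * L"
        using Ls by (simp add: algebra_simps)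
    qed (use d P(3)[OF p] in auto)
    also have "\<dots> = A * L * \<delta> p"
      by (simp add: A_def algebra_simps)
    finally show "(\<Sum>k\<in>{k\<in>{..K}. side \<Phi> k < R p}. prob (N k p) * (2 * side \<Phi> k)) \<le> A * L * \<delta> p" .
  qed simp
  also have "\<dots> = 1 / 250 * c"
    unfolding c_def
    by (subst transport_cost_offdiag[OF finX f]) (simp_all add: P_def \<delta>_def sum_distrib_left algebra_simps)
  finally have EZ: "expectation Z \<le> 1 / 250 * c" .
  have Z0: "0 \<le> Z \<sigma>" for \<sigma>
    unfolding Z_def using side_pos[OF \<Phi>] by (intro sum_nonneg mult_nonneg_nonneg) (auto simp: J_def less_imp_le)
  define B2 where "B2 = {\<sigma> \<in> space (shift_measure \<Phi>). c < Z \<sigma>}"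
  have B2: "B2 \<in> events"
    using borel_measurable_integrable[OF intZ] unfolding B2_def by measurable
  have pB2: "prob B2 \<le> 1 / 250"
    unfolding B2_def by (rule prob_gt_le[OF intZ Z0 EZ]) simp
  have "prob (B1 \<union> B2) \<le> 1 / 125"
    using measure_Un_le[OF B1 B2] pB1 pB2 by simp
  moreover have "transport_cost X (tree_dist X \<Phi> (vec_lambda \<sigma>)) f \<le> c" if "\<sigma> \<notin> B1 \<union> B2" for \<sigma>
  proof -
    have "transport_cost X (tree_dist X \<Phi> (vec_lambda \<sigma>)) f =
        (\<Sum>p\<in>P. pmf f p * tree_dist X \<Phi> (vec_lambda \<sigma>) (fst p) (snd p))"
      unfolding P_def by (rule transport_cost_offdiag[OF finX f tree_dist_self])
    also have "\<dots> \<le> Z \<sigma>"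
      unfolding Z_def
    proof (intro sum_mono mult_left_mono)
      fix p assume p: "p \<in> P"
      have "tree_dist X \<Phi> (vec_lambda \<sigma>) (fst p) (snd p) \<le>
          (\<Sum>k\<le>K. of_bool (cell \<Phi> (vec_lambda \<sigma>) k (fst p) \<noteq> cell \<Phi> (vec_lambda \<sigma>) k (snd p)) * (2 * side \<Phi> k))"
        using K by (intro tree_dist_le[OF \<Phi> finX _ P(1,2)[OF p]]) blast
      also have "\<dots> = (\<Sum>k\<le>K. J k p \<sigma> * (2 * side \<Phi> k))"
        by (intro sum.cong) (auto simp: J_def N_def)
      \<comment> \<open>Outside \<open>B1\<close> the indicator vanishes at every omitted
        depth.\<close>
      also have "\<dots> = (\<Sum>k\<in>{k\<in>{..K}. side \<Phi> k < R p}. J k p \<sigma> * (2 * side \<Phi> k))"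
        using that p by (intro sum.mono_neutral_right) (auto simp: J_def B1_def not_less)
      finally show "tree_dist X \<Phi> (vec_lambda \<sigma>) (fst p) (snd p) \<le> \<dots>" .
    qed simp
    also have "\<dots> \<le> c"
      using that by (auto simp: B2_def space_shift)
    finally show ?thesis .
  qed
  ultimately show ?thesis
    using B1 B2 unfolding c_def A_def L_def by (intro bexI[of _ "B1 \<union> B2"] conjI allI impI) auto
qed

section \<open>Measurability\<close>

text \<open>\<open>Q\<close> depends only on the truth pattern of the conditions in
  \<open>D\<close>. There are finitely many patterns, each cuts out a measurable set, and the set of
  \<open>Q\<close> is the union over the patterns that some point satisfying \<open>Q\<close>
  realizes.\<close>

lemma sets_Collect_finitely_determined:
  assumes "finite D" "\<And>b. b \<in> D \<Longrightarrow> {\<omega> \<in> space M. T b \<omega>} \<in> sets M"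
    and det: "\<And>\<omega> \<omega>'. (\<forall>b\<in>D. T b \<omega> = T b \<omega>') \<Longrightarrow> Q \<omega> = Q \<omega>'"
  shows "{\<omega> \<in> space M. Q \<omega>} \<in> sets M"
proof -
  have "{\<omega> \<in> space M. Q \<omega>} =
      (\<Union>A\<in>{A \<in> Pow D. \<exists>\<omega>. Q \<omega> \<and> A = {b \<in> D. T b \<omega>}}. {\<omega> \<in> space M. \<forall>b\<in>D. T b \<omega> = (b \<in> A)})"
    (is "_ = ?U")
  proof (intro set_eqI iffI)
    fix \<omega> assume "\<omega> \<in> {\<omega> \<in> space M. Q \<omega>}"
    then show "\<omega> \<in> ?U"
      by (intro UN_I[of "{b \<in> D. T b \<omega>}"]) auto
  next
    fix \<omega> assume "\<omega> \<in> ?U"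
    then obtain \<omega>' where "\<omega> \<in> space M" "Q \<omega>'" "\<forall>b\<in>D. T b \<omega> = T b \<omega>'"
      by auto
    then show "\<omega> \<in> {\<omega> \<in> space M. Q \<omega>}"
      using det by auto
  qed
  moreover have "{\<omega> \<in> space M. T b \<omega> = (b \<in> A)} \<in> sets M" if "b \<in> D" for b A
    using assms(2)[OF that] by (cases "b \<in> A") (auto intro: sets.sets_Collect_neg)
  then have "{\<omega> \<in> space M. \<forall>b\<in>D. T b \<omega> = (b \<in> A)} \<in> sets M" for A
    using assms(1) by (intro sets.sets_Collect_finite_All) auto
  ultimately show ?thesis
    using assms(1) by (auto intro!: sets.finite_UN)
qed

text \<open>The shift enters only through the tree costs of pairs in \<open>X\<close>.\<close>

lemma flowtree_nearest_cong:
  assumes "\<And>x y. x \<in> X \<Longrightarrow> y \<in> X \<Longrightarrow> tree_dist X \<Phi> \<sigma> x y = tree_dist X \<Phi> \<sigma>' x y"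
  shows "flowtree_nearest X \<Phi> \<sigma> n \<mu> \<nu> i = flowtree_nearest X \<Phi> \<sigma>' n \<mu> \<nu> i"
proof -
  have "transport_cost X (tree_dist X \<Phi> \<sigma>) = transport_cost X (tree_dist X \<Phi> \<sigma>')"
    unfolding transport_cost_def using assms by (intro ext sum.cong) auto
  then show ?thesis
    by (simp add: flowtree_nearest_def optimal_flow_def)
qed

text \<open>
  Neither the choice among optimal flows nor the property \<open>G\<close> carries any measurability, but on \<open>X\<close>
  the tree metric is determined by finitely many measurable conditions on the shift: which points
  share a cell down to the depth where all points are separated, and which points lie in the root.
\<close>

lemma sets_flowtree_nearest:
  fixes X :: "(real ^ 'd) set"
  assumes \<Phi>: "\<Phi> > 0" and X: "scaled \<Phi> X"
  shows "{\<sigma> \<in> space (shift_measure \<Phi>). \<forall>i. flowtree_nearest X \<Phi> (vec_lambda \<sigma>) n \<mu> \<nu> i \<longrightarrow> G i}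
    \<in> sets (shift_measure \<Phi>)"
proof -
  have finX: "finite X"
    using X by (simp add: scaled_def)
  obtain K where K: "\<forall>k\<ge>K. \<forall>\<sigma>. \<forall>x\<in>X. \<forall>y\<in>X. cell \<Phi> \<sigma> k x = cell \<Phi> \<sigma> k y \<longrightarrow> x = y"
    using ex_depth[OF \<Phi> X] by blast
  define T where "T = case_sum
    (\<lambda>(k, x, y) \<sigma>. cell \<Phi> (vec_lambda \<sigma>) k x = cell \<Phi> (vec_lambda \<sigma>) k y)
    (\<lambda>x \<sigma> :: 'd \<Rightarrow> real. cell \<Phi> (vec_lambda \<sigma>) 0 x = 0)"
  show ?thesis
  proof (rule sets_Collect_finitely_determined[where D = "({..K} \<times> X \<times> X) <+> X" and T = T])
    show "finite (({..K} \<times> X \<times> X) <+> X)"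
      using finX by simp
    show "{\<sigma> \<in> space (shift_measure \<Phi>). T b \<sigma>} \<in> sets (shift_measure \<Phi>)" for b
    proof (cases b)
      case (Inl p)
      obtain k x y where "p = (k, x, y)"
        by (cases p)
      then show ?thesis
        unfolding Inl T_def using measurable_cell_eq[of \<Phi> k x y] by (simp add: pred_def)
    next
      case (Inr x)
      have "Measurable.pred (shift_measure \<Phi>) (\<lambda>\<sigma>. cell \<Phi> (vec_lambda \<sigma>) 0 x = 0)"
        unfolding vec_eq_iff by measurable
      then show ?thesis
        unfolding Inr T_def by (simp add: pred_def)
    qed
    fix \<sigma> \<sigma>' :: "'d \<Rightarrow> real"
    assume same: "\<forall>b\<in>({..K} \<times> X \<times> X) <+> X. T b \<sigma> = T b \<sigma>'"
    have cells: "cell \<Phi> (vec_lambda \<sigma>) k x = cell \<Phi> (vec_lambda \<sigma>) k y \<longleftrightarrow>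
        cell \<Phi> (vec_lambda \<sigma>') k x = cell \<Phi> (vec_lambda \<sigma>') k y"
      if "k \<le> K" "x \<in> X" "y \<in> X" for k x y
      using same[rule_format, of "Inl (k, x, y)"] that by (auto simp: T_def)
    have root: "cell \<Phi> (vec_lambda \<sigma>) 0 x = 0 \<longleftrightarrow> cell \<Phi> (vec_lambda \<sigma>') 0 x = 0" if "x \<in> X" for x
      using same[rule_format, of "Inr x"] that by (auto simp: T_def)
    \<comment> \<open>Depth \<open>Suc j\<close> is decided by the cells at depth \<open>j\<close>,
      so the conditions up to \<open>K\<close> suffice.\<close>
    have path: "on_path X \<Phi> (vec_lambda \<sigma>) k x \<longleftrightarrow> on_path X \<Phi> (vec_lambda \<sigma>') k x" if "k \<le> K" "x \<in> X" for k x
    proof (cases k)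
      case 0
      then show ?thesis
        using root that by (simp add: on_path_def)
    next
      case (Suc j)
      then have "{y \<in> X. cell \<Phi> (vec_lambda \<sigma>) j y = cell \<Phi> (vec_lambda \<sigma>) j x} =
          {y \<in> X. cell \<Phi> (vec_lambda \<sigma>') j y = cell \<Phi> (vec_lambda \<sigma>') j x}"
        using cells that by auto
      then show ?thesis
        using root that Suc by (simp add: on_path_def split_at_def)
    qed
    have "tree_dist X \<Phi> (vec_lambda \<sigma>) x y = tree_dist X \<Phi> (vec_lambda \<sigma>') x y" if "x \<in> X" "y \<in> X" for x y
    proof -
      have eq: "tree_dist X \<Phi> \<tau> x y = (\<Sum>k\<le>K. of_bool (cell \<Phi> \<tau> k x \<noteq> cell \<Phi> \<tau> k y) * side \<Phi> k *
          (of_bool (on_path X \<Phi> \<tau> k x) + of_bool (on_path X \<Phi> \<tau> k y)))" for \<tau>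
        using K by (intro tree_dist_eq[OF \<Phi> finX _ that]) blast
      show ?thesis
        unfolding eq using cells path that by (intro sum.cong) auto
    qed
    then show "(\<forall>i. flowtree_nearest X \<Phi> (vec_lambda \<sigma>) n \<mu> \<nu> i \<longrightarrow> G i) =
        (\<forall>i. flowtree_nearest X \<Phi> (vec_lambda \<sigma>') n \<mu> \<nu> i \<longrightarrow> G i)"
      using flowtree_nearest_cong by blast
  qed
qed

section \<open>Near-optimal couplings\<close>

lemma eucl_cost_nonneg: "0 \<le> eucl_cost X \<tau>"
  unfolding transport_cost_def by (intro sum_nonneg) auto

lemma W1_le_eucl_cost: "\<tau> \<in> couplings X \<mu> \<nu> \<Longrightarrow> W1 X \<mu> \<nu> \<le> eucl_cost X \<tau>"
  unfolding W1_def by (intro cINF_lower bdd_belowI2[where m = 0] eucl_cost_nonneg) auto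

text \<open>Each unit of mass off the diagonal travels at least distance 1, so the cost bounds the
  probability that the two components differ. The events \<open>fst p = x\<close> and
  \<open>snd p = x\<close> disagree only there.\<close>

lemma pmf_diff_le_eucl_cost:
  assumes "finite X" "\<forall>x\<in>X. \<forall>y\<in>X. x \<noteq> y \<longrightarrow> 1 \<le> norm (x - y)" "\<tau> \<in> couplings X \<mu> \<nu>"
  shows "\<bar>pmf \<mu> x - pmf \<nu> x\<bar> \<le> eucl_cost X \<tau>"
proof -
  have sub: "set_pmf \<tau> \<subseteq> X \<times> X" and \<mu>: "\<mu> = map_pmf fst \<tau>" and \<nu>: "\<nu> = map_pmf snd \<tau>"
    using assms(3) by (auto simp: couplings_def)
  let ?D = "{p\<in>set_pmf \<tau>. fst p \<noteq> snd p}"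
  have fin: "finite ?D"
    using finite_subset[OF sub] assms(1) by simp
  have "measure_pmf.prob \<tau> {p. fst p \<noteq> snd p} = measure_pmf.prob \<tau> ?D"
    by (intro measure_prob_cong_0) (auto simp: set_pmf_iff)
  also have "\<dots> = (\<Sum>p\<in>?D. pmf \<tau> p * 1)"
    using fin by (simp add: measure_measure_pmf_finite)
  also have "\<dots> \<le> (\<Sum>p\<in>?D. pmf \<tau> p * norm (fst p - snd p))"
    using sub assms(2) by (intro sum_mono mult_left_mono) auto
  also have "\<dots> = eucl_cost X \<tau>"
    using transport_cost_offdiag[OF assms(1) sub, of "\<lambda>x y. norm (x - y)"] by simp
  finally have D: "measure_pmf.prob \<tau> {p. fst p \<noteq> snd p} \<le> eucl_cost X \<tau>" .
  have le: "measure_pmf.prob \<tau> A \<le> measure_pmf.prob \<tau> A' + eucl_cost X \<tau>"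
    if "A \<subseteq> A' \<union> {p. fst p \<noteq> snd p}" for A A'
  proof -
    have "measure_pmf.prob \<tau> A \<le> measure_pmf.prob \<tau> (A' \<union> {p. fst p \<noteq> snd p})"
      using that by (intro measure_pmf.finite_measure_mono) auto
    also have "\<dots> \<le> measure_pmf.prob \<tau> A' + measure_pmf.prob \<tau> {p. fst p \<noteq> snd p}"
      by (intro measure_Un_le) auto
    finally show ?thesis
      using D by linarith
  qed
  have "fst -` {x} \<subseteq> snd -` {x} \<union> {p. fst p \<noteq> snd p}" "snd -` {x} \<subseteq> fst -` {x} \<union> {p. fst p \<noteq> snd p}"
    by auto
  from this[THEN le] show ?thesis
    unfolding \<mu> \<nu> pmf_map by linarith
qed

text \<open>
  The factor 2 avoids a compactness argument: if the infimum is zero, then the distributions agree,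
  because distinct points have distance at least one.
\<close>

lemma near_optimal_coupling:
  assumes "finite X" "\<forall>x\<in>X. \<forall>y\<in>X. x \<noteq> y \<longrightarrow> 1 \<le> norm (x - y)" "set_pmf \<mu> \<subseteq> X" "set_pmf \<nu> \<subseteq> X"
  obtains \<tau> where "\<tau> \<in> couplings X \<mu> \<nu>" "eucl_cost X \<tau> \<le> 2 * W1 X \<mu> \<nu>"
proof -
  have "pair_pmf \<mu> \<nu> \<in> couplings X \<mu> \<nu>"
    using assms(3,4) by (auto simp: couplings_def map_fst_pair_pmf map_snd_pair_pmf)
  then have ne: "couplings X \<mu> \<nu> \<noteq> {}"
    by auto
  have W0: "0 \<le> W1 X \<mu> \<nu>"
    unfolding W1_def by (intro cINF_greatest ne eucl_cost_nonneg)
  show ?thesis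
  proof (cases "W1 X \<mu> \<nu> = 0")
    case True
    have "\<bar>pmf \<mu> x - pmf \<nu> x\<bar> \<le> W1 X \<mu> \<nu>" for x
      unfolding W1_def by (intro cINF_greatest ne pmf_diff_le_eucl_cost assms(1,2))
    then have eq: "\<mu> = \<nu>"
      using True by (intro pmf_eqI) simp
    let ?\<tau> = "map_pmf (\<lambda>x. (x, x)) \<mu>"
    have "?\<tau> \<in> couplings X \<mu> \<nu>"
      using assms(3) eq by (auto simp: couplings_def pmf.map_comp o_def)
    moreover have "eucl_cost X ?\<tau> = 0"
      using assms(3) by (subst transport_cost_offdiag[OF assms(1)]) (auto intro!: sum.neutral)
    ultimately show ?thesis
      using that W0 by auto
  next
    case False
    then have "W1 X \<mu> \<nu> < 2 * W1 X \<mu> \<nu>"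
      using W0 by simp
    then have "\<not> (\<forall>\<tau>\<in>couplings X \<mu> \<nu>. 2 * W1 X \<mu> \<nu> \<le> eucl_cost X \<tau>)"
      using cINF_greatest[OF ne, of "2 * W1 X \<mu> \<nu>" "eucl_cost X"] by (auto simp flip: W1_def)
    then obtain \<tau> where "\<tau> \<in> couplings X \<mu> \<nu>" "eucl_cost X \<tau> < 2 * W1 X \<mu> \<nu>"
      by (auto simp: not_le)
    then show ?thesis
      using that by auto
  qed
qed

section \<open>From the tree cost of one coupling to the approximation ratio\<close>

theorem theorem3p5:
  shows "\<exists>C>0. \<forall>(\<Phi>::real) (X :: (real ^ 'd) set) (s::nat) (n::nat)
           (\<mu> :: nat \<Rightarrow> (real ^ 'd) pmf) (\<nu> :: (real ^ 'd) pmf).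
      \<Phi> > 0 \<longrightarrow> scaled \<Phi> X \<longrightarrow>
      (\<forall>j\<in>{1..n}. set_pmf (\<mu> j) \<subseteq> X \<and> quantized s (\<mu> j)) \<longrightarrow>
      set_pmf \<nu> \<subseteq> X \<and> quantized s \<nu> \<longrightarrow>
      measure (shift_measure \<Phi>)
        {\<sigma> \<in> space (shift_measure \<Phi>).
           \<forall>i. flowtree_nearest X \<Phi> (vec_lambda \<sigma>) n \<mu> \<nu> i \<longrightarrow>
               approx_nearest X (C * max 1 ((log 2 (real s))\<^sup>2)) n \<mu> \<nu> i}
        \<ge> 99 / 100"
proof -
  define d where "d = real CARD('d)"
  have d: "1 \<le> d"
    by (simp add: d_def Suc_leI)
  define A where "A = 4 + 4 * d * (log 2 (1000 * d) + 3)"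
  have "0 \<le> log 2 (1000 * d)"
    using d by (intro zero_le_log_cancel_iff[THEN iffD2]) auto
  then have A: "0 < A"
    using d unfolding A_def by (intro add_pos_nonneg mult_nonneg_nonneg) auto
  \<comment> \<open>In the constant, \<open>d\<close> compares the Euclidean with the tree metric,
    and 500 is 250 from Markov's inequality times 2 from the near-optimal coupling. It depends on
    the dimension only.\<close>
  have "99 / 100 \<le> measure (shift_measure \<Phi>)
        {\<sigma> \<in> space (shift_measure \<Phi>).
           \<forall>i. flowtree_nearest X \<Phi> (vec_lambda \<sigma>) n \<mu> \<nu> i \<longrightarrow>
               approx_nearest X (500 * d * A * max 1 ((log 2 (real s))\<^sup>2)) n \<mu> \<nu> i}"
    (is "_ \<le> measure _ ?E")
    if \<Phi>: "\<Phi> > 0" and X: "scaled \<Phi> X"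
      and \<mu>: "\<forall>j\<in>{1..n}. set_pmf (\<mu> j) \<subseteq> X \<and> quantized s (\<mu> j)"
      and \<nu>: "set_pmf \<nu> \<subseteq> X \<and> quantized s \<nu>"
    for \<Phi> s n and X :: "(real ^ 'd) set" and \<mu> \<nu>
  proof -
    interpret prob_space "shift_measure \<Phi> :: ('d \<Rightarrow> real) measure"
      by (rule prob_space_shift[OF \<Phi>])
    define L where "L = max 1 ((log 2 (real s))\<^sup>2)"
    have finX: "finite X" and sep: "\<forall>x\<in>X. \<forall>y\<in>X. x \<noteq> y \<longrightarrow> 1 \<le> norm (x - y)"
      using X by (auto simp: scaled_def)
    show ?thesis
    \<comment> \<open>For \<open>n = 0\<close> the minimum ranges over the empty set, but no index
      is a Flowtree nearest neighbor and the event is the whole space.\<close>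
    proof (cases "n = 0")
      case True
      then have "?E = space (shift_measure \<Phi>)"
        by (auto simp: flowtree_nearest_def)
      then show ?thesis
        using prob_space by simp
    next
      case False
      then have "Min ((\<lambda>j. W1 X (\<mu> j) \<nu>) ` {1..n}) \<in> (\<lambda>j. W1 X (\<mu> j) \<nu>) ` {1..n}"
        by (intro Min_in) auto
      then obtain m where m: "m \<in> {1..n}" "Min ((\<lambda>j. W1 X (\<mu> j) \<nu>) ` {1..n}) = W1 X (\<mu> m) \<nu>"
        by auto
      \<comment> \<open>This coupling belongs to the true nearest neighbor \<open>m\<close> and does
        not depend on the shift.\<close>
      obtain f where f: "f \<in> couplings X (\<mu> m) \<nu>" "eucl_cost X f \<le> 2 * W1 X (\<mu> m) \<nu>"
        using near_optimal_coupling[OF finX sep] \<mu> \<nu> m(1) by blast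
      have fX: "set_pmf f \<subseteq> X \<times> X"
        using f(1) by (auto simp: couplings_def)
      have "set_pmf (\<mu> m) = fst ` set_pmf f" "set_pmf \<nu> = snd ` set_pmf f"
        using f(1) by (auto simp: couplings_def simp flip: set_map_pmf)
      then have "set_pmf f \<subseteq> set_pmf (\<mu> m) \<times> set_pmf \<nu>"
        by (simp add: subset_fst_snd)
      moreover have "finite (set_pmf (\<mu> m))" "finite (set_pmf \<nu>)"
        using \<mu> \<nu> m(1) finX finite_subset by blast+
      ultimately have "card (set_pmf f) \<le> card (set_pmf (\<mu> m)) * card (set_pmf \<nu>)"
        by (metis card_cartesian_product card_mono finite_cartesian_product)
      also have "\<dots> \<le> s * s"
        using \<mu> \<nu> m(1) by (intro mult_mono) (auto simp: quantized_def)
      finally have card: "card (set_pmf f) \<le> s\<^sup>2"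
        by (simp add: power2_eq_square)
      have s: "1 \<le> s"
        using \<nu> by (auto simp: quantized_def)
      obtain B where B: "B \<in> events" "prob B \<le> 1 / 125"
        "\<And>\<sigma>. \<sigma> \<notin> B \<Longrightarrow> transport_cost X (tree_dist X \<Phi> (vec_lambda \<sigma>)) f \<le> 250 * (A * L) * eucl_cost X f"
        using tree_cost_bound[OF \<Phi> X fX card s] unfolding A_def L_def d_def by blast
      obtain K where K: "\<forall>k\<ge>K. \<forall>\<sigma>. \<forall>x\<in>X. \<forall>y\<in>X. cell \<Phi> \<sigma> k x = cell \<Phi> \<sigma> k y \<longrightarrow> x = y"
        using ex_depth[OF \<Phi> X] by blast
      \<comment> \<open>Only almost everywhere, because comparing the metrics requires all of
        \<open>X\<close> to lie in the root.\<close>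
      have "AE \<sigma> in shift_measure \<Phi>. \<sigma> \<in> space (shift_measure \<Phi>) - B \<longrightarrow> \<sigma> \<in> ?E"
        using AE_in_root[OF \<Phi> X]
      proof eventually_elim
        case (elim \<sigma>)
        show ?case
        proof (intro impI CollectI conjI allI)
          fix i
          assume \<sigma>: "\<sigma> \<in> space (shift_measure \<Phi>) - B"
            and "flowtree_nearest X \<Phi> (vec_lambda \<sigma>) n \<mu> \<nu> i"
          then obtain F where i: "i \<in> {1..n}"
            and F: "\<And>j. j \<in> {1..n} \<Longrightarrow> optimal_flow X (tree_dist X \<Phi> (vec_lambda \<sigma>)) (\<mu> j) \<nu> (F j)"
            and Fi: "\<And>j. j \<in> {1..n} \<Longrightarrow> eucl_cost X (F i) \<le> eucl_cost X (F j)"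
            unfolding flowtree_nearest_def by blast
          \<comment> \<open>The index \<open>i\<close> and the flows \<open>F\<close> may depend on
            the shift. The chain passes from \<open>F i\<close> to \<open>F m\<close> and, by tree
            optimality, to the fixed \<open>f\<close>, the only flow for which a probabilistic bound
            is used.\<close>
          have "W1 X (\<mu> i) \<nu> \<le> eucl_cost X (F i)"
            using F[OF i] by (intro W1_le_eucl_cost) (simp add: optimal_flow_def is_arg_min_def)
          also have "\<dots> \<le> eucl_cost X (F m)"
            by (rule Fi[OF m(1)])
          also have "\<dots> \<le> d * transport_cost X (tree_dist X \<Phi> (vec_lambda \<sigma>)) (F m)"
            unfolding transport_cost_def sum_distrib_left
          proof (rule sum_mono, clarify)
            fix x y assume xy: "x \<in> X" "y \<in> X"
            have "norm (x - y) \<le> d * tree_dist X \<Phi> (vec_lambda \<sigma>) x y"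
              unfolding d_def using K elim xy by (intro norm_le_tree_dist[OF \<Phi> finX]) blast+
            then show "pmf (F m) (x, y) * norm (x - y) \<le>
                d * (pmf (F m) (x, y) * tree_dist X \<Phi> (vec_lambda \<sigma>) x y)"
              using mult_left_mono[OF _ pmf_nonneg[of "F m" "(x, y)"]] by (metis mult.left_commute)
          qed
          also have "\<dots> \<le> d * transport_cost X (tree_dist X \<Phi> (vec_lambda \<sigma>)) f"
            using F[OF m(1)] f(1) d
            by (intro mult_left_mono) (auto simp: optimal_flow_def is_arg_min_def not_less)
          also have "\<dots> \<le> d * (250 * (A * L) * (2 * W1 X (\<mu> m) \<nu>))"
          proof (rule mult_left_mono)
            have "transport_cost X (tree_dist X \<Phi> (vec_lambda \<sigma>)) f \<le> 250 * (A * L) * eucl_cost X f"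
              using \<sigma> B(3) by blast
            also have "\<dots> \<le> 250 * (A * L) * (2 * W1 X (\<mu> m) \<nu>)"
              using f(2) A by (intro mult_left_mono) (auto simp: L_def)
            finally show "transport_cost X (tree_dist X \<Phi> (vec_lambda \<sigma>)) f \<le> \<dots>" .
          qed (use d in simp)
          finally have "W1 X (\<mu> i) \<nu> \<le> 500 * d * A * L * W1 X (\<mu> m) \<nu>"
            by (simp add: mult_ac)
          then show "approx_nearest X (500 * d * A * max 1 ((log 2 (real s))\<^sup>2)) n \<mu> \<nu> i"
            unfolding approx_nearest_def m(2) using i by (simp add: L_def)
        qed simp
      qed
      then have "prob (space (shift_measure \<Phi>) - B) \<le> prob ?E"
        by (rule finite_measure_mono_AE) (rule sets_flowtree_nearest[OF \<Phi> X])
      then show ?thesis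
        using prob_compl[OF B(1)] B(2) by simp
    qed
  qed
  moreover have "0 < 500 * d * A"
    using d A by simp
  ultimately show ?thesis
    by blast
qed

end
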